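(* Let $k$ be a positive integer. For every $n\ge 1$, $$\left(\frac{x}{(1-x)^k}\frac{d}{dx}\right)^n\frac{1}{1-x}=\frac{C_n(x;k+1)}{(1-x)^{n+kn+1}},\qquad \left(kx\frac{d}{dx}\right)^n\frac{1}{(1-x)^{1/k}}=\frac{x^nA_n^{(k)}(1/x)}{(1-x)^{n+\frac1k}}.$$ In particular, with $C_n(x)=C_n(x;2)$, $$\left(\frac{x}{1-x}\frac{d}{dx}\right)^n\frac{1}{1-x}=\frac{C_n(x)}{(1-x)^{2n+1}},\qquad \left(2x\frac{d}{dx}\right)^n\frac{1}{\sqrt{1-x}}=\frac{N_n(x)}{(1-x)^{n}\sqrt{1-x}}.$$
   Context: For a function $h(x)$, $\left(h(x)\frac{d}{dx}\right)^n$ denotes the $n$-fold composition of the operator $g\mapsto h\cdot g'$. The identities are identities of functions of $x$ (for real $x<1$), or equivalently of formal power series in $x$, where $(1-x)^{-1/k}$ has constant term $1$. For an integer $m\ge1$, an $m$-Stirling permutation of order $n$ is a permutation $\sigma=\sigma_1\sigma_2\cdots\sigma_{mn}$ of the multiset $\{1^m,2^m,\ldots,n^m\}$ such that for each $i$ with $1\le i\le n$, all entries between any two occurrences of $i$ are at least $i$. Let $\mathcal{Q}_n(m)$ be the set of these. A descent of $\sigma\in\mathcal Q_n(m)$ is an index $i\in\{1,\ldots,mn\}$ such that $\sigma_i>\sigma_{i+1}$ or $i=mn$; $\mathrm{des}(\sigma)$ is the number of descents. The $m$-order Eulerian polynomials are $C_n(x;m)=\sum_{\sigma\in\mathcal Q_n(m)}x^{\mathrm{des}(\sigma)}$,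 with $C_0(x;m)=1$. The second-order Eulerian polynomial is $C_n(x)=C_n(x;2)$. For a positive integer $k$, the $1/k$-Eulerian polynomials $A_n^{(k)}(x)$ are defined by $$\sum_{n=0}^\infty A_{n}^{(k)}(x)\frac{z^n}{n!}=\left(\frac{1-x}{e^{kz(x-1)}-x}\right)^{\frac{1}{k}}.$$ The expression $x^nA_n^{(k)}(1/x)$ is understood as the resulting polynomial in $x$. The left ascent plateau polynomial is $N_n(x)=\sum_{\sigma\in\mathcal Q_n(2)}x^{\mathrm{lap}(\sigma)}$, where $\mathrm{lap}(\sigma)$ is the number of indices $i\in\{1,2,\ldots,2n-1\}$ such that $\sigma_{i-1}<\sigma_i=\sigma_{i+1}$, with the convention $\sigma_0=0$. *)

theory Defs
  imports "HOL-Analysis.Analysis" "HOL-Computational_Algebra.Computational_Algebra"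
begin

definition stirling_perms :: "nat \<Rightarrow> nat \<Rightarrow> nat list set" where
  "stirling_perms m n = {\<sigma>. mset \<sigma> = (\<Sum>i\<in>{1..n}. replicate_mset m i) \<and>
     (\<forall>i\<in>{1..n}. \<forall>a b c. a < b \<and> b < c \<and> c < length \<sigma> \<and> \<sigma> ! a = i \<and> \<sigma> ! c = i \<longrightarrow> i \<le> \<sigma> ! b)}"

text \<open>List positions start at 0, so \<open>(0 # \<sigma>) ! i\<close> is the entry \<open>\<sigma>\<^sub>i\<close> of the 1-based word
  \<open>\<sigma>\<^sub>1 \<sigma>\<^sub>2 \<dots>\<close> and \<open>(0 # \<sigma>) ! 0\<close> is the conventional entry \<open>\<sigma>\<^sub>0 = 0\<close>.\<close>

definition des :: "nat list \<Rightarrow> nat" where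
  "des \<sigma> = card {i \<in> {1..length \<sigma>}. i = length \<sigma> \<or> (0 # \<sigma>) ! i > (0 # \<sigma>) ! (i + 1)}"

definition lap :: "nat list \<Rightarrow> nat" where
  "lap \<sigma> = card {i \<in> {1..<length \<sigma>}.
     (0 # \<sigma>) ! (i - 1) < (0 # \<sigma>) ! i \<and> (0 # \<sigma>) ! i = (0 # \<sigma>) ! (i + 1)}"

definition m_eulerian_poly :: "nat \<Rightarrow> nat \<Rightarrow> real poly" where
  "m_eulerian_poly m n = (\<Sum>\<sigma>\<in>stirling_perms m n. monom 1 (des \<sigma>))"

definition second_order_eulerian_poly :: "nat \<Rightarrow> real poly" where
  "second_order_eulerian_poly n = m_eulerian_poly 2 n"

definition lap_poly :: "nat \<Rightarrow> real poly" where
  "lap_poly n = (\<Sum>\<sigma>\<in>stirling_perms 2 n. monom 1 (lap \<sigma>))"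

text \<open>For a fixed real \<open>x \<noteq> 1\<close>, the power series in \<open>z\<close> of
  \<open>((1 - x) / (exp (k z (x - 1)) - x)) powr (1/k)\<close>. The quotient has constant term 1, and
  the \<open>k\<close>-th root is the one with constant term 1.\<close>

definition frac_eulerian_gf :: "nat \<Rightarrow> real \<Rightarrow> real fps" where
  "frac_eulerian_gf k x =
     fps_radical root k (fps_const (1 - x) / (fps_exp (real k * (x - 1)) - fps_const x))"

text \<open>The quotient is degenerate (0/0) at \<open>x = 1\<close>; a polynomial is determined by its values
  at the remaining points.\<close>

definition frac_eulerian_poly :: "nat \<Rightarrow> nat \<Rightarrow> real poly" where
  "frac_eulerian_poly k =
     (THE A. \<forall>x. x \<noteq> 1 \<longrightarrow> Abs_fps (\<lambda>n. poly (A n) x / fact n) = frac_eulerian_gf k x)"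

text \<open>The polynomial \<open>x\<^sup>n p(1/x)\<close>. The library's \<open>reflect_poly\<close> uses
  \<open>degree p\<close> in place of \<open>n\<close>.\<close>

definition reversed_poly :: "nat \<Rightarrow> real poly \<Rightarrow> real poly" where
  "reversed_poly n p = (THE q. \<forall>x. x \<noteq> 0 \<longrightarrow> poly q x = x ^ n * poly p (1 / x))"

definition diff_op :: "(real \<Rightarrow> real) \<Rightarrow> (real \<Rightarrow> real) \<Rightarrow> real \<Rightarrow> real" where
  "diff_op h g = (\<lambda>x. h x * deriv g x)"

end

(* Every identity has the same shape: if g_n = P_n / (1-x)^(a_n), then applying c x/(1-x)^k d/dx
   gives P_(n+1) / (1-x)^(a_n + k + 1) with P_(n+1) = c x ((1-x) P_n' + a_n P_n).  It remains to see
   that the polynomial families satisfy these recurrences.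

   For Stirling permutations the m copies of n+1 are adjacent, so Q_(n+1)(m) arises uniquely by
   inserting this block into one of the mn+1 gaps of some element of Q_n(m).  The number
   of descents is unchanged for exactly des gaps and grows by one for the others; the number of
   left ascent plateaus (m = 2) is unchanged for exactly 2 lap gaps and grows by one for the others.

   For the 1/k-Eulerian polynomials, the polynomials A_n defined by the reversed recurrence have
   a generating function F with L F = F for a first-order linear differential operator L.  Since L
   is a derivation, F^k (exp(kz(x-1)) - x) and 1 - x solve the same equation L W = k x W and
   have the same constant term in z, so they are equal. *)
theory Submission
  imports Defs "HOL-Library.Sublist"
begin

unbundle no vec_syntax
unbundle fps_syntax

section \<open>Iterating the differential operator\<close>

text \<open>\<open>deriv\<close> at a point sees values nearby, so the induction carries equality on
  all of \<open>S\<close>; openness of \<open>S\<close> then transfers the derivative of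
  \<open>g n\<close> to the iterate.\<close>

lemma diff_op_funpow_eq:
  fixes g :: "nat \<Rightarrow> real \<Rightarrow> real"
  assumes "open S"
    and f: "\<And>x. x \<in> S \<Longrightarrow> f x = g 0 x"
    and der: "\<And>n x. x \<in> S \<Longrightarrow> (g n has_real_derivative g' n x) (at x)"
    and step: "\<And>n x. x \<in> S \<Longrightarrow> g (Suc n) x = h x * g' n x"
    and "x \<in> S"
  shows "(diff_op h ^^ n) f x = g n x"
  using \<open>x \<in> S\<close>
proof (induction n arbitrary: x)
  case 0
  then show ?case by (simp add: f)
next
  case (Suc n)
  have "((diff_op h ^^ n) f has_real_derivative g' n x) (at x)"
    by (rule has_field_derivative_transform_within_open[OF der \<open>open S\<close>])
      (use Suc in simp_all)
  then show ?case
    using Suc.prems by (simp add: diff_op_def[of h "(diff_op h ^^ n) f"] DERIV_imp_deriv step)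
qed

text \<open>Real exponents let one statement serve the integer powers as well as those shifted by
  1/k. The numerator of the derivative comes from the product rule for P and the negative power of 1
  - x.\<close>

lemma diff_op_funpow_quotient:
  fixes P :: "nat \<Rightarrow> real poly" and a :: "nat \<Rightarrow> real"
  assumes f: "\<And>x. x < 1 \<Longrightarrow> f x = poly (P 0) x / (1 - x) powr a 0"
    and h: "\<And>x. x < 1 \<Longrightarrow> h x = c * x / (1 - x) ^ k"
    and a: "\<And>n. a (Suc n) = a n + real k + 1"
    and P: "\<And>n. P (Suc n) =
      smult c ([:0, 1:] * ([:1, -1:] * pderiv (P n) + smult (a n) (P n)))"
    and "x < 1"
  shows "(diff_op h ^^ n) f x = poly (P n) x / (1 - x) powr a n"
proof (rule diff_op_funpow_eq[where S = "{..<1}" and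
      g' = "\<lambda>n x. ((1 - x) * poly (pderiv (P n)) x + a n * poly (P n) x) / (1 - x) powr (a n + 1)"])
  fix n and x :: real
  assume "x \<in> {..<1}"
  then have x: "1 - x > 0" by simp
  define u where "u = (1 - x) powr a n"
  have u: "u > 0"
    using x by (simp add: u_def)
  have powr: "(1 - x) powr (a n + 1) = u * (1 - x)" "(1 - x) powr (- a n) = 1 / u"
    "(1 - x) powr (- a n - 1) = 1 / (u * (1 - x))"
    using x by (simp_all add: u_def powr_add powr_diff powr_minus_divide)
  have "((\<lambda>x. (1 - x) powr (- a n)) has_real_derivative a n * (1 - x) powr (- a n - 1)) (at x)"
    using x by (auto intro!: derivative_eq_intros simp: powr_diff)
  then have "((\<lambda>x. poly (P n) x * (1 - x) powr (- a n)) has_real_derivative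
      ((1 - x) * poly (pderiv (P n)) x + a n * poly (P n) x) / (1 - x) powr (a n + 1)) (at x)"
    by (rule DERIV_cong[OF DERIV_mult[OF poly_DERIV]], unfold powr)
      (use x u in \<open>simp add: divide_simps\<close>)
  then show "((\<lambda>x. poly (P n) x / (1 - x) powr a n) has_real_derivative
      ((1 - x) * poly (pderiv (P n)) x + a n * poly (P n) x) / (1 - x) powr (a n + 1)) (at x)"
    by (simp only: powr_minus divide_inverse)
  have "(1 - x) powr a (Suc n) = (1 - x) powr (a n + 1) * (1 - x) ^ k"
    using x by (simp add: a powr_add powr_realpow ac_simps)
  then show "poly (P (Suc n)) x / (1 - x) powr a (Suc n) =
      h x * (((1 - x) * poly (pderiv (P n)) x + a n * poly (P n) x) / (1 - x) powr (a n + 1))"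
    using x by (simp add: h P diff_divide_distrib add_divide_distrib algebra_simps)
qed (use f \<open>x < 1\<close> in auto)

text \<open>A nonzero polynomial has finitely many roots. The excluded point allows for 1/x at 0 and
  for the degenerate quotient at 1; the lemma also reduces polynomial recurrences to pointwise
  algebra.\<close>

lemma poly_eqI_cofinite:
  fixes p q :: "real poly"
  assumes "\<And>x. x \<noteq> c \<Longrightarrow> poly p x = poly q x"
  shows "p = q"
proof (rule ccontr)
  assume "p \<noteq> q"
  then have "finite {x. poly (p - q) x = 0}"
    by (intro poly_roots_finite) simp
  moreover have "- {c} \<subseteq> {x. poly (p - q) x = 0}"
    using assms by auto
  ultimately have "finite (- {c})"
    using finite_subset by blast
  then show False
    using infinite_UNIV_char_0[where 'a = real] by (metis finite_compl finite.emptyI finite.insertI)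
qed

lemma pderiv_sum: "pderiv (sum f A) = (\<Sum>i\<in>A. pderiv (f i))"
  using higher_pderiv_sum[of 1] by simp

lemma of_nat_mult_poly: "of_nat n * p = smult (real n) p"
  by (simp add: of_nat_poly)

section \<open>Inserting the largest block into a Stirling permutation\<close>

text \<open>The Stirling condition says that every subsequence \<open>[i, j, i]\<close> has \<open>i \<le> j\<close>; this form is
  inherited by subsequences.\<close>

lemma subseq_triple_iff:
  "subseq [x, y, z] xs \<longleftrightarrow>
    (\<exists>a b c. a < b \<and> b < c \<and> c < length xs \<and> xs ! a = x \<and> xs ! b = y \<and> xs ! c = z)"
proof
  assume "subseq [x, y, z] xs"
  then obtain us vs where us: "xs = us @ x # vs" and "subseq [y, z] vs"
    by (auto dest: list_emb_ConsD)
  then obtain vs' ws where vs: "vs = vs' @ y # ws" and "subseq [z] ws"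
    by (auto dest: list_emb_ConsD)
  then obtain ws' zs where ws: "ws = ws' @ z # zs"
    by (metis subseq_singleton_left split_list)
  show "\<exists>a b c. a < b \<and> b < c \<and> c < length xs \<and> xs ! a = x \<and> xs ! b = y \<and> xs ! c = z"
    by (rule exI[of _ "length us"], rule exI[of _ "length us + length vs' + 1"],
        rule exI[of _ "length us + length vs' + length ws' + 2"])
      (simp add: us vs ws nth_append)
next
  assume "\<exists>a b c. a < b \<and> b < c \<and> c < length xs \<and> xs ! a = x \<and> xs ! b = y \<and> xs ! c = z"
  then obtain a b c where *: "a < b" "b < c" "c < length xs" "xs ! a = x" "xs ! b = y" "xs ! c = z"
    by blast
  have "subseq ([x] @ [y] @ [z]) (take b xs @ take (c - b) (drop b xs) @ drop c xs)"
  proof (intro list_emb_append_mono)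
    show "subseq [x] (take b xs)"
      using * by (auto simp: subseq_singleton_left in_set_conv_nth intro!: exI[of _ a])
    show "subseq [y] (take (c - b) (drop b xs))"
      using * by (auto simp: subseq_singleton_left in_set_conv_nth intro!: exI[of _ 0])
    show "subseq [z] (drop c xs)"
      using * by (auto simp: subseq_singleton_left in_set_conv_nth intro!: exI[of _ 0])
  qed
  moreover have "take b xs @ take (c - b) (drop b xs) @ drop c xs = xs"
    using * by (metis append.assoc append_take_drop_id le_add_diff_inverse less_imp_le take_add)
  ultimately show "subseq [x, y, z] xs" by simp
qed

lemma set_mset_sum_replicate:
  "m \<ge> 1 \<Longrightarrow> set_mset (\<Sum>i\<in>{1..n}. replicate_mset m i) = {1..n::nat}"
  by (auto simp: set_mset_sum)

text \<open>Every letter of a subsequence of \<open>\<sigma>\<close> is an entry of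
  \<open>\<sigma>\<close>, and the multiset condition puts it in {1..n}; hence quantifying over all
  \<open>i\<close> agrees with the bounded quantifier.\<close>

lemma stirling_perms_iff:
  assumes "m \<ge> 1"
  shows "\<sigma> \<in> stirling_perms m n \<longleftrightarrow>
    mset \<sigma> = (\<Sum>i\<in>{1..n}. replicate_mset m i) \<and> (\<forall>i j. subseq [i, j, i] \<sigma> \<longrightarrow> i \<le> j)"
proof -
  have "set \<sigma> = {1..n}" if "mset \<sigma> = (\<Sum>i\<in>{1..n}. replicate_mset m i)"
    using that set_mset_sum_replicate[OF assms] by (metis set_mset_mset)
  then have in_range: "i \<in> {1..n}"
    if "mset \<sigma> = (\<Sum>i\<in>{1..n}. replicate_mset m i)" "subseq [i, j, i] \<sigma>" for i j
    using that by (metis subseq_Cons' subseq_singleton_left)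
  show ?thesis
  proof (intro iffI conjI allI impI)
    assume \<sigma>: "\<sigma> \<in> stirling_perms m n"
    then show mset: "mset \<sigma> = (\<Sum>i\<in>{1..n}. replicate_mset m i)"
      by (simp add: stirling_perms_def)
    fix i j
    assume sub: "subseq [i, j, i] \<sigma>"
    then obtain a b c where "a < b" "b < c" "c < length \<sigma>" "\<sigma> ! a = i" "\<sigma> ! b = j" "\<sigma> ! c = i"
      unfolding subseq_triple_iff by blast
    then show "i \<le> j"
      using \<sigma> in_range[OF mset sub] unfolding stirling_perms_def by blast
  next
    assume "mset \<sigma> = (\<Sum>i\<in>{1..n}. replicate_mset m i) \<and> (\<forall>i j. subseq [i, j, i] \<sigma> \<longrightarrow> i \<le> j)"
    then show "\<sigma> \<in> stirling_perms m n"
      unfolding stirling_perms_def subseq_triple_iff by blast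
  qed
qed

lemma stirling_perms_set:
  "m \<ge> 1 \<Longrightarrow> \<sigma> \<in> stirling_perms m n \<Longrightarrow> set \<sigma> = {1..n}"
  by (metis set_mset_mset set_mset_sum_replicate stirling_perms_iff)

lemma stirling_perms_length: "\<sigma> \<in> stirling_perms m n \<Longrightarrow> length \<sigma> = m * n"
proof -
  have "size (\<Sum>i\<in>{1..n}. replicate_mset m i) = m * n"
    by (simp add: size_multiset_sum)
  then show "\<sigma> \<in> stirling_perms m n \<Longrightarrow> length \<sigma> = m * n"
    unfolding stirling_perms_def by (metis (mono_tags, lifting) mem_Collect_eq size_mset)
qed

lemma stirling_perms_0: "stirling_perms m 0 = {[]}"
  by (auto simp: stirling_perms_def)

section \<open>Insertion of a block of equal letters as a bijection\<close>

definition insert_block :: "nat \<Rightarrow> nat \<Rightarrow> nat list \<Rightarrow> nat \<Rightarrow> nat list" where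
  "insert_block m v \<sigma> j = take j \<sigma> @ replicate m v @ drop j \<sigma>"

text \<open>Deleting \<open>v\<close> recovers the word, and by the next lemma the position of the
  first \<open>v\<close> recovers the gap; together they give injectivity of insertion.\<close>

lemma filter_insert_block: "v \<notin> set \<sigma> \<Longrightarrow> filter (\<lambda>y. y \<noteq> v) (insert_block m v \<sigma> j) = \<sigma>"
proof -
  assume v: "v \<notin> set \<sigma>"
  then have "filter (\<lambda>y. y \<noteq> v) (take j \<sigma>) = take j \<sigma>" "filter (\<lambda>y. y \<noteq> v) (drop j \<sigma>) = drop j \<sigma>"
    by (auto simp: filter_id_conv dest: in_set_takeD in_set_dropD)
  then show ?thesis by (simp add: insert_block_def)
qed

lemma length_takeWhile_insert_block:
  assumes "v \<notin> set \<sigma>" and "m \<ge> 1" and "j \<le> length \<sigma>"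
  shows "length (takeWhile (\<lambda>y. y \<noteq> v) (insert_block m v \<sigma> j)) = j"
proof -
  have "\<forall>y\<in>set (take j \<sigma>). y \<noteq> v"
    using assms by (auto dest: in_set_takeD)
  moreover obtain m' where "m = Suc m'"
    using assms by (cases m) auto
  ultimately show ?thesis
    using assms by (simp add: insert_block_def takeWhile_append2 takeWhile_append)
qed

text \<open>The first \<open>v\<close> cannot be matched in \<open>xs\<close> and the last cannot be
  matched in \<open>ys\<close>, so the whole triple is matched inside the block.\<close>

lemma subseq_in_block:
  assumes "subseq [v, y, v] (xs @ replicate m v @ ys)" and "v \<notin> set xs" and "v \<notin> set ys"
  shows "y = v"
proof -
  have drop_left: "subseq (v # us) vs" if "subseq (v # us) (ws @ vs)" "v \<notin> set ws" for us vs ws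
    using that by (induction ws) (auto simp: list_emb_Cons_iff1 split: if_splits)
  have "subseq [v, y, v] (replicate m v @ ys)"
    by (rule drop_left[OF assms(1,2)])
  then obtain us ws where split: "[v, y, v] = us @ ws" and us: "subseq us (replicate m v)"
    and ws: "subseq ws ys"
    by (rule subseq_appendE)
  have "ws = []"
  proof (rule ccontr)
    assume "ws \<noteq> []"
    then have "last ws = v"
      using split by (metis last.simps last_appendR list.distinct(1))
    then have "v \<in> set ys"
      using ws last_in_set[OF \<open>ws \<noteq> []\<close>] by (auto elim: list_emb_set)
    with assms(3) show False by simp
  qed
  with split us have "subseq [v, y, v] (replicate m v)"
    by simp
  then obtain z where "z \<in> set (replicate m v)" and "y = z"
    by (rule list_emb_set[where x = y]) auto
  then show ?thesis
    by (simp split: if_splits)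
qed

lemma bij_betw_insert_block:
  assumes "m \<ge> 1"
  shows "bij_betw (\<lambda>(\<sigma>, j). insert_block m (Suc n) \<sigma> j)
    (stirling_perms m n \<times> {..m * n}) (stirling_perms m (Suc n))"
  unfolding bij_betw_def
proof (intro conjI set_eqI iffI)
  have v: "Suc n \<notin> set \<sigma>" if "\<sigma> \<in> stirling_perms m n" for \<sigma>
    using stirling_perms_set[OF assms that] by simp
  show "inj_on (\<lambda>(\<sigma>, j). insert_block m (Suc n) \<sigma> j) (stirling_perms m n \<times> {..m * n})"
  proof (rule inj_onI, clarify)
    fix \<sigma> \<sigma>' j j'
    assume *: "\<sigma> \<in> stirling_perms m n" "\<sigma>' \<in> stirling_perms m n" "j \<le> m * n" "j' \<le> m * n"
      and eq: "insert_block m (Suc n) \<sigma> j = insert_block m (Suc n) \<sigma>' j'"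
    then show "\<sigma> = \<sigma>' \<and> j = j'"
      by (metis v assms filter_insert_block length_takeWhile_insert_block stirling_perms_length)
  qed
  show "\<tau> \<in> stirling_perms m (Suc n)"
    if "\<tau> \<in> (\<lambda>(\<sigma>, j). insert_block m (Suc n) \<sigma> j) ` (stirling_perms m n \<times> {..m * n})" for \<tau>
  proof -
    from that obtain \<sigma> j where \<sigma>: "\<sigma> \<in> stirling_perms m n"
      and \<tau>: "\<tau> = insert_block m (Suc n) \<sigma> j" by auto
    have "mset \<sigma> = (\<Sum>i\<in>{1..n}. replicate_mset m i)"
      using \<sigma> by (simp add: stirling_perms_def)
    moreover have "mset \<tau> = mset \<sigma> + replicate_mset m (Suc n)"
      by (simp add: \<tau> insert_block_def flip: mset_append[of "take j \<sigma>" "drop j \<sigma>"])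
    ultimately have "mset \<tau> = (\<Sum>i\<in>{1..Suc n}. replicate_mset m i)"
      by simp
    \<comment> \<open>A violating triple has k < i. The block rules out i = n + 1, so both letters
      are at most n and the triple survives deletion of the block, violating the condition in
      \<open>\<sigma>\<close>.\<close>
    moreover have "i \<le> k" if sub: "subseq [i, k, i] \<tau>" for i k
    proof (rule ccontr)
      assume "\<not> i \<le> k"
      have "set \<tau> \<subseteq> {1..Suc n}"
        using \<open>mset \<tau> = (\<Sum>i\<in>{1..Suc n}. replicate_mset m i)\<close>
          set_mset_sum_replicate[OF assms, of "Suc n"] by (metis set_mset_mset subset_refl)
      then have "i \<le> Suc n"
        using sub by (metis atLeastAtMost_iff subseq_Cons' subseq_singleton_left subset_iff)
      moreover have "i \<noteq> Suc n"
        using subseq_in_block[of "Suc n" k "take j \<sigma>" m "drop j \<sigma>"] sub v[OF \<sigma>] \<open>\<not> i \<le> k\<close>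
        by (auto simp: \<tau> insert_block_def dest: in_set_takeD in_set_dropD)
      ultimately have "i \<noteq> Suc n" "k \<noteq> Suc n"
        using \<open>\<not> i \<le> k\<close> by auto
      then have "subseq [i, k, i] \<sigma>"
        using subseq_filter[OF sub, of "\<lambda>y. y \<noteq> Suc n"]
        by (simp add: \<tau> filter_insert_block[OF v[OF \<sigma>]])
      then show False
        using \<sigma> \<open>\<not> i \<le> k\<close> stirling_perms_iff[OF assms] by blast
    qed
    ultimately show ?thesis
      using stirling_perms_iff[OF assms] by blast
  qed
  show "\<tau> \<in> (\<lambda>(\<sigma>, j). insert_block m (Suc n) \<sigma> j) ` (stirling_perms m n \<times> {..m * n})"
    if \<tau>: "\<tau> \<in> stirling_perms m (Suc n)" for \<tau>
  proof -
    have set: "set \<tau> = {1..Suc n}"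
      using stirling_perms_set[OF assms \<tau>] .
    have stir: "i \<le> k" if "subseq [i, k, i] \<tau>" for i k
      using \<tau> that stirling_perms_iff[OF assms] by blast
    have mset: "mset \<tau> = (\<Sum>i\<in>{1..n}. replicate_mset m i) + replicate_mset m (Suc n)"
      using \<tau> by (simp add: stirling_perms_def)
    \<comment> \<open>Cut at the first maximal run \<open>c\<close> of the letter n + 1. It remains
      to show that \<open>b\<close> has no further copy, so that \<open>c\<close> is the whole
      block.\<close>
    define a where "a = takeWhile (\<lambda>y. y \<noteq> Suc n) \<tau>"
    define c where "c = takeWhile (\<lambda>y. y = Suc n) (dropWhile (\<lambda>y. y \<noteq> Suc n) \<tau>)"
    define b where "b = dropWhile (\<lambda>y. y = Suc n) (dropWhile (\<lambda>y. y \<noteq> Suc n) \<tau>)"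
    have \<tau>_eq: "\<tau> = a @ c @ b"
      by (simp add: a_def b_def c_def)
    have a: "Suc n \<notin> set a"
      by (auto simp: a_def dest: set_takeWhileD)
    have c: "c = replicate (length c) (Suc n)"
      by (rule replicate_eqI[symmetric, THEN sym]) (auto simp: c_def dest: set_takeWhileD)
    have "dropWhile (\<lambda>y. y \<noteq> Suc n) \<tau> \<noteq> []"
      using set by auto
    then have "c \<noteq> []"
        using hd_dropWhile[of "\<lambda>y. y \<noteq> Suc n" \<tau>]
      by (cases "dropWhile (\<lambda>y. y \<noteq> Suc n) \<tau>") (auto simp: c_def)
    have b: "Suc n \<notin> set b"
    proof
      assume "Suc n \<in> set b"
      then have "b \<noteq> []" by auto
      then have "hd b \<noteq> Suc n"
        unfolding b_def by (rule hd_dropWhile)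
      with \<open>Suc n \<in> set b\<close> have "Suc n \<in> set (tl b)"
        by (cases b) auto
      \<comment> \<open>A later copy would enclose \<open>hd b\<close> between two letters n + 1,
        although \<open>hd b\<close> is different from n + 1 and hence smaller.\<close>
      have "subseq ([Suc n] @ [hd b] @ [Suc n]) (c @ [hd b] @ tl b)"
        using \<open>c \<noteq> []\<close> \<open>Suc n \<in> set (tl b)\<close> c
        by (intro list_emb_append_mono)
          (auto simp: subseq_singleton_left, metis in_set_replicate length_0_conv)
      then have "subseq [Suc n, hd b, Suc n] \<tau>"
        using \<open>b \<noteq> []\<close> by (simp add: \<tau>_eq subseq_drop_many)
      then have "Suc n \<le> hd b" by (rule stir)
      moreover have "hd b \<in> set \<tau>"
        using \<open>b \<noteq> []\<close> by (simp add: \<tau>_eq)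
      ultimately show False
        using set \<open>hd b \<noteq> Suc n\<close> by auto
    qed
    have "count (mset \<tau>) (Suc n) = m"
      unfolding mset by (auto simp: count_sum)
    moreover have "count (mset \<tau>) (Suc n) = length c"
      using a b c by (metis (no_types, lifting) \<tau>_eq add.left_neutral add.right_neutral
          count_mset_0_iff count_replicate_mset mset_append mset_replicate count_union)
    ultimately have c': "c = replicate m (Suc n)"
      using c by simp
    have "mset (a @ b) = (\<Sum>i\<in>{1..n}. replicate_mset m i)"
      using mset by (simp add: \<tau>_eq c')
    moreover have "subseq (a @ b) \<tau>"
      by (simp add: \<tau>_eq subseq_append' subseq_drop_many)
    ultimately have ab: "a @ b \<in> stirling_perms m n"
      using stir stirling_perms_iff[OF assms] subseq_order.trans by blast
    moreover have "length a \<le> m * n"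
      using stirling_perms_length[OF ab] by simp
    moreover have "\<tau> = insert_block m (Suc n) (a @ b) (length a)"
      by (simp add: insert_block_def \<tau>_eq c')
    ultimately show ?thesis by force
  qed
qed

lemma sum_stirling_perms_Suc:
  assumes "m \<ge> 1"
  shows "(\<Sum>\<tau>\<in>stirling_perms m (Suc n). f \<tau>)
    = (\<Sum>\<sigma>\<in>stirling_perms m n. \<Sum>j\<le>m * n. f (insert_block m (Suc n) \<sigma> j))"
  using sum.reindex_bij_betw[OF bij_betw_insert_block[OF assms], of f]
  by (simp add: sum.cartesian_product case_prod_unfold)

section \<open>Descents and left ascent plateaus under insertion\<close>

definition entry :: "nat list \<Rightarrow> nat \<Rightarrow> nat" where
  "entry \<sigma> i = (0 # \<sigma>) ! i"

text \<open>Cutting \<open>0 # \<sigma>\<close> after \<open>Suc j\<close> letters keeps the leading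
  0 in the first piece, so index 0 needs no separate case. Positions past the end are covered too,
  since the list equations used put no upper bound on \<open>i\<close>.\<close>

lemma entry_insert_block:
  assumes "j \<le> length \<sigma>"
  shows "entry (insert_block m v \<sigma> j) i =
    (if i \<le> j then entry \<sigma> i else if i \<le> j + m then v else entry \<sigma> (i - m))"
proof -
  have "0 # insert_block m v \<sigma> j =
      take (Suc j) (0 # \<sigma>) @ replicate m v @ drop (Suc j) (0 # \<sigma>)"
    by (simp add: insert_block_def)
  moreover have "Suc j \<le> length (0 # \<sigma>)"
    using assms by simp
  ultimately show ?thesis
    using assms by (simp only: entry_def nth_append nth_drop length_take length_replicate min_absorb2)
      (auto simp: nth_take less_Suc_eq_le simp del: take_Suc_Cons drop_Suc_Cons)
qed

lemma length_insert_block [simp]: "length (insert_block m v \<sigma> j) = length \<sigma> + m"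
  by (simp add: insert_block_def)

definition descents :: "nat list \<Rightarrow> nat set" where
  "descents \<sigma> = {i \<in> {1..length \<sigma>}. i = length \<sigma> \<or> entry \<sigma> i > entry \<sigma> (i + 1)}"

definition plateaus :: "nat list \<Rightarrow> nat set" where
  "plateaus \<sigma> = {i \<in> {1..<length \<sigma>}.
     entry \<sigma> (i - 1) < entry \<sigma> i \<and> entry \<sigma> i = entry \<sigma> (i + 1)}"

lemma finite_descents [simp]: "finite (descents \<sigma>)"
  by (simp add: descents_def)

lemma finite_plateaus [simp]: "finite (plateaus \<sigma>)"
  by (simp add: plateaus_def)

lemma des_eq: "des \<sigma> = card (descents \<sigma>)"
  by (simp add: des_def descents_def entry_def)

lemma lap_eq: "lap \<sigma> = card (plateaus \<sigma>)"
  by (simp add: lap_def plateaus_def entry_def)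

lemma entry_less:
  assumes "\<forall>y\<in>set \<sigma>. y < v" and "1 \<le> i" and "i \<le> length \<sigma>"
  shows "entry \<sigma> i < v"
  using assms by (cases i) (auto simp: entry_def)

text \<open>The step into the block rises and the block is constant, so neither gives a descent. Its
  last copy, at \<open>j + m\<close>, always does: a smaller letter or the end of the word follows.
  Later descents shift by \<open>m\<close>.\<close>

lemma descents_insert_block:
  assumes less: "\<forall>y\<in>set \<sigma>. y < v" and "m \<ge> 1" and j: "j \<le> length \<sigma>"
  shows "descents (insert_block m v \<sigma> j) =
    {i \<in> descents \<sigma>. i < j} \<union> insert (j + m) ((\<lambda>i. i + m) ` {i \<in> descents \<sigma>. i > j})"
    (is "?L = ?R")
proof (rule set_eqI)
  fix i
  consider "i < j" | "i = j" | "j < i" "i < j + m" | "i = j + m" | "i > j + m"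
    by linarith
  then show "i \<in> ?L \<longleftrightarrow> i \<in> ?R"
  proof cases
    case 2
    then show ?thesis
      using assms entry_less[OF less, of j]
      by (auto simp: descents_def entry_insert_block)
  next
    case 4
    then show ?thesis
      using assms entry_less[OF less, of "Suc j"]
      by (cases "j = length \<sigma>") (auto simp: descents_def entry_insert_block)
  next
    case 5
    then have "i = (i - m) + m" "i - m > j"
      by linarith+
    then obtain i' where "i = i' + m" "i' > j"
      by blast
    then show ?thesis
      using assms by (auto simp: descents_def entry_insert_block)
  qed (use assms in \<open>auto simp: descents_def entry_insert_block\<close>)
qed

text \<open>The descent at \<open>j + m\<close> is gained, and one at \<open>j\<close> is lost if it
  was there.\<close>

lemma des_insert_block:
  assumes "\<forall>y\<in>set \<sigma>. y < v" and "m \<ge> 1" and "j \<le> length \<sigma>"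
  shows "des (insert_block m v \<sigma> j) = des \<sigma> + (if j \<in> descents \<sigma> then 0 else 1)"
proof -
  have "des (insert_block m v \<sigma> j) =
      card ({i \<in> descents \<sigma>. i < j} \<union> insert (j + m) ((\<lambda>i. i + m) ` {i \<in> descents \<sigma>. i > j}))"
    unfolding descents_insert_block[OF assms, symmetric] by (rule des_eq)
  also have "\<dots> = card {i \<in> descents \<sigma>. i < j} + card (insert (j + m) ((\<lambda>i. i + m) ` {i \<in> descents \<sigma>. i > j}))"
    by (rule card_Un_disjoint) auto
  also have "\<dots> = card {i \<in> descents \<sigma>. i < j} + Suc (card {i \<in> descents \<sigma>. i > j})"
    by (subst card_insert_disjoint) (auto simp: card_image inj_on_def)
  also have "\<dots> = Suc (card ({i \<in> descents \<sigma>. i < j} \<union> {i \<in> descents \<sigma>. i > j}))"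
    by (subst card_Un_disjoint) auto
  also have "{i \<in> descents \<sigma>. i < j} \<union> {i \<in> descents \<sigma>. i > j} = descents \<sigma> - {j}"
    by auto
  finally have "des (insert_block m v \<sigma> j) = Suc (card (descents \<sigma> - {j}))" .
  moreover have "des \<sigma> = card (descents \<sigma>)"
    by (rule des_eq)
  moreover have "j \<in> descents \<sigma> \<Longrightarrow> card (descents \<sigma>) > 0"
    by (auto simp: card_gt_0_iff)
  ultimately show ?thesis
    by (simp add: card_Diff_singleton_if)
qed

text \<open>The block makes a plateau at \<open>j + 1\<close>. An old plateau at \<open>j\<close>
  loses its equal right neighbour, and one at \<open>j + 1\<close> gets the larger left neighbour
  \<open>v\<close>, so both disappear; the rest persist, shifted by 2 if to the right.\<close>

lemma plateaus_insert_block: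
  assumes less: "\<forall>y\<in>set \<sigma>. y < v" and "v > 0" and j: "j \<le> length \<sigma>"
  shows "plateaus (insert_block 2 v \<sigma> j) =
    {i \<in> plateaus \<sigma>. i < j} \<union> insert (j + 1) ((\<lambda>i. i + 2) ` {i \<in> plateaus \<sigma>. i > j + 1})"
    (is "?L = ?R")
proof (rule set_eqI)
  fix i
  consider "i < j" | "i = j" | "i = j + 1" | "i = j + 2" | "i = j + 3" | "i > j + 3"
    by linarith
  then show "i \<in> ?L \<longleftrightarrow> i \<in> ?R"
  proof cases
    case 2
    then show ?thesis
      using assms entry_less[OF less, of j]
      by (auto simp: plateaus_def entry_insert_block)
  next
    case 3
    \<comment> \<open>For j = 0 this is the conventional entry 0 being below \<open>v\<close>, which
      is where \<open>v > 0\<close> enters.\<close>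
    have "entry \<sigma> j < v"
      using assms entry_less[OF less, of j] by (cases "j = 0") (auto simp: entry_def)
    with 3 show ?thesis
      using assms by (auto simp: plateaus_def entry_insert_block)
  next
    case 5
    then show ?thesis
      using assms entry_less[OF less, of "Suc j"]
      by (auto simp: plateaus_def entry_insert_block)
  next
    case 6
    then have "i = (i - 2) + 2" "i - 2 > j + 1"
      by linarith+
    then obtain i' where "i = i' + 2" "i' > j + 1"
      by blast
    then show ?thesis
      using assms by (auto simp: plateaus_def entry_insert_block)
  qed (use assms in \<open>auto simp: plateaus_def entry_insert_block\<close>)
qed

text \<open>Ensures that an insertion destroys at most one plateau, and that the two families of
  gaps counted in \<open>card_lap_gaps\<close> are disjoint.\<close>

lemma plateaus_not_consecutive: "i \<in> plateaus \<sigma> \<Longrightarrow> Suc i \<notin> plateaus \<sigma>"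
  by (auto simp: plateaus_def)

lemma lap_insert_block:
  assumes "\<forall>y\<in>set \<sigma>. y < v" and "v > 0" and "j \<le> length \<sigma>"
  shows "lap (insert_block 2 v \<sigma> j) =
    lap \<sigma> + (if j \<in> plateaus \<sigma> \<union> {i. Suc i \<in> plateaus \<sigma>} then 0 else 1)"
proof -
  have "lap (insert_block 2 v \<sigma> j) = card ({i \<in> plateaus \<sigma>. i < j} \<union>
      insert (j + 1) ((\<lambda>i. i + 2) ` {i \<in> plateaus \<sigma>. i > j + 1}))"
    unfolding plateaus_insert_block[OF assms, symmetric] by (rule lap_eq)
  also have "\<dots> = card {i \<in> plateaus \<sigma>. i < j} +
      card (insert (j + 1) ((\<lambda>i. i + 2) ` {i \<in> plateaus \<sigma>. i > j + 1}))"
    by (rule card_Un_disjoint) auto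
  also have "\<dots> = card {i \<in> plateaus \<sigma>. i < j} + Suc (card {i \<in> plateaus \<sigma>. i > j + 1})"
    by (subst card_insert_disjoint) (auto simp: card_image inj_on_def)
  also have "\<dots> = Suc (card ({i \<in> plateaus \<sigma>. i < j} \<union> {i \<in> plateaus \<sigma>. i > j + 1}))"
    by (subst card_Un_disjoint) auto
  also have "{i \<in> plateaus \<sigma>. i < j} \<union> {i \<in> plateaus \<sigma>. i > j + 1} = plateaus \<sigma> - {j} - {Suc j}"
    by auto
  finally have "lap (insert_block 2 v \<sigma> j) = Suc (card (plateaus \<sigma> - {j} - {Suc j}))" .
  moreover have "lap \<sigma> = card (plateaus \<sigma>)"
    by (rule lap_eq)
  moreover have "i \<in> plateaus \<sigma> \<Longrightarrow> card (plateaus \<sigma>) > 0" for i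
    by (auto simp: card_gt_0_iff)
  ultimately show ?thesis
    using plateaus_not_consecutive[of j \<sigma>] by (auto simp: card_Diff_singleton_if)
qed

text \<open>A block inserted at gap \<open>j\<close> always forms a new left ascent plateau; it destroys an old one
  \<open>\<sigma>\<^sub>i\<^sub>-\<^sub>1 < \<sigma>\<^sub>i = \<sigma>\<^sub>i\<^sub>+\<^sub>1\<close> iff \<open>j\<close> is one of the two gaps \<open>i - 1\<close>, \<open>i\<close> inside it.\<close>

lemma card_lap_gaps: "card (plateaus \<sigma> \<union> {i. Suc i \<in> plateaus \<sigma>}) = 2 * lap \<sigma>"
proof -
  have Suc_image: "plateaus \<sigma> = Suc ` {i. Suc i \<in> plateaus \<sigma>}"
  proof (intro set_eqI iffI)
    fix i
    assume "i \<in> plateaus \<sigma>"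
    then show "i \<in> Suc ` {i. Suc i \<in> plateaus \<sigma>}"
      by (cases i) (auto simp: plateaus_def)
  qed auto
  then have "card {i. Suc i \<in> plateaus \<sigma>} = card (plateaus \<sigma>)"
    by (metis card_image inj_Suc inj_on_subset subset_UNIV)
  moreover have "finite {i. Suc i \<in> plateaus \<sigma>}"
    using Suc_image by (metis finite_imageD finite_plateaus inj_Suc inj_on_subset subset_UNIV)
  ultimately show ?thesis
    using plateaus_not_consecutive[of _ \<sigma>]
    by (subst card_Un_disjoint) (auto simp: lap_eq)
qed

text \<open>A word with statistic d has c d gaps that keep d and mn + 1 - c d that raise it, so x^d
  becomes c d x^d + (mn + 1 - c d) x^(d+1). Writing d x^d as x (x^d)' makes this linear in x^d and
  its derivative, independently of d.\<close>

lemma stirling_perms_generating_poly_Suc: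
  fixes stat :: "nat list \<Rightarrow> nat"
  assumes "m \<ge> 1"
    and B: "\<And>\<sigma>. \<sigma> \<in> stirling_perms m n \<Longrightarrow> B \<sigma> \<subseteq> {..m * n} \<and> card (B \<sigma>) = c * stat \<sigma>"
    and stat: "\<And>\<sigma> j. \<sigma> \<in> stirling_perms m n \<Longrightarrow> j \<le> m * n \<Longrightarrow>
      stat (insert_block m (Suc n) \<sigma> j) = stat \<sigma> + (if j \<in> B \<sigma> then 0 else 1)"
  shows "(\<Sum>\<tau>\<in>stirling_perms m (Suc n). monom (1::real) (stat \<tau>)) =
    [:0, real c, - real c:] * pderiv (\<Sum>\<sigma>\<in>stirling_perms m n. monom 1 (stat \<sigma>))
    + [:0, real (m * n) + 1:] * (\<Sum>\<sigma>\<in>stirling_perms m n. monom 1 (stat \<sigma>))"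
proof -
  have "(\<Sum>j\<le>m * n. monom (1::real) (stat (insert_block m (Suc n) \<sigma> j))) =
      [:0, real c, - real c:] * pderiv (monom 1 (stat \<sigma>)) + [:0, real (m * n) + 1:] * monom 1 (stat \<sigma>)"
    if \<sigma>: "\<sigma> \<in> stirling_perms m n" for \<sigma>
  proof -
    let ?d = "stat \<sigma>"
    \<comment> \<open>The bound \<open>c * ?d \<le> Suc (m * n)\<close> turns the truncated natural
      subtraction into a real one below.\<close>
    have B\<sigma>: "{..m * n} \<inter> B \<sigma> = B \<sigma>" "card ({..m * n} \<inter> - B \<sigma>) = Suc (m * n) - c * ?d"
      "c * ?d \<le> Suc (m * n)"
      using B[OF \<sigma>] card_mono[of "{..m * n}" "B \<sigma>"] finite_subset[of "B \<sigma>" "{..m * n}"]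
      by (auto simp: Int_absorb1 card_Diff_subset simp flip: Diff_eq)
    have "(\<Sum>j\<le>m * n. monom (1::real) (stat (insert_block m (Suc n) \<sigma> j))) =
        (\<Sum>j\<le>m * n. if j \<in> B \<sigma> then monom 1 ?d else monom 1 (Suc ?d))"
      by (rule sum.cong) (auto simp: stat[OF \<sigma>])
    also have "\<dots> = smult (real (c * ?d)) (monom 1 ?d)
        + smult (real (Suc (m * n)) - real (c * ?d)) (monom 1 (Suc ?d))"
      using B[OF \<sigma>] B\<sigma>
      by (simp add: sum.If_cases of_nat_mult_poly flip: of_nat_diff del: of_nat_Suc of_nat_mult)
    also have "\<dots> = [:0, real c, - real c:] * pderiv (monom 1 ?d) + [:0, real (m * n) + 1:] * monom 1 ?d"
      by (rule poly_eqI_cofinite[where c = 0], cases ?d)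
        (simp_all add: poly_monom pderiv_monom algebra_simps)
    finally show ?thesis .
  qed
  then show ?thesis
    unfolding sum_stirling_perms_Suc[OF \<open>m \<ge> 1\<close>] pderiv_sum
      sum_distrib_left sum.distrib[symmetric]
    by (rule sum.cong[OF refl])
qed

lemma stirling_perms_less:
  "m \<ge> 1 \<Longrightarrow> \<sigma> \<in> stirling_perms m n \<Longrightarrow> \<forall>y\<in>set \<sigma>. y < Suc n"
  using stirling_perms_set by fastforce

lemma m_eulerian_poly_Suc:
  assumes "m \<ge> 1"
  shows "m_eulerian_poly m (Suc n) =
    [:0, 1, -1:] * pderiv (m_eulerian_poly m n) + [:0, real (m * n) + 1:] * m_eulerian_poly m n"
proof -
  have "descents \<sigma> \<subseteq> {..m * n} \<and> card (descents \<sigma>) = 1 * des \<sigma>" if "\<sigma> \<in> stirling_perms m n" for \<sigma>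
    using stirling_perms_length[OF that] by (auto simp: descents_def des_eq)
  moreover have "des (insert_block m (Suc n) \<sigma> j) = des \<sigma> + (if j \<in> descents \<sigma> then 0 else 1)"
    if "\<sigma> \<in> stirling_perms m n" "j \<le> m * n" for \<sigma> j
    using that assms stirling_perms_less[OF assms]
    by (intro des_insert_block) (auto simp: stirling_perms_length)
  ultimately show ?thesis
    unfolding m_eulerian_poly_def
    using stirling_perms_generating_poly_Suc[OF assms, of n descents 1 des] by simp
qed

lemma lap_poly_Suc:
  "lap_poly (Suc n) = [:0, 2, -2:] * pderiv (lap_poly n) + [:0, real (2 * n) + 1:] * lap_poly n"
proof -
  let ?B = "\<lambda>\<sigma>. plateaus \<sigma> \<union> {i. Suc i \<in> plateaus \<sigma>}"
  have "?B \<sigma> \<subseteq> {..2 * n} \<and> card (?B \<sigma>) = 2 * lap \<sigma>" if "\<sigma> \<in> stirling_perms 2 n" for \<sigma>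
    using stirling_perms_length[OF that] by (auto simp: card_lap_gaps) (auto simp: plateaus_def)
  moreover have "lap (insert_block 2 (Suc n) \<sigma> j) = lap \<sigma> + (if j \<in> ?B \<sigma> then 0 else 1)"
    if "\<sigma> \<in> stirling_perms 2 n" "j \<le> 2 * n" for \<sigma> j
    using that stirling_perms_less[of 2]
    by (intro lap_insert_block) (auto simp: stirling_perms_length)
  ultimately show ?thesis
    unfolding lap_poly_def
    using stirling_perms_generating_poly_Suc[of 2 n ?B 2 lap] by simp
qed

section \<open>The generating function of the 1/k-Eulerian polynomials\<close>

text \<open>Explicit candidate for the 1/k-Eulerian polynomials, identified with
  \<open>frac_eulerian_poly\<close> through its generating function.\<close>

primrec euler_frac :: "nat \<Rightarrow> nat \<Rightarrow> real poly" where
  "euler_frac k 0 = 1"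
| "euler_frac k (Suc n) = [:1, real k * real n:] * euler_frac k n
     + [:0, real k, - real k:] * pderiv (euler_frac k n)"

text \<open>The recurrence of \<open>euler_frac\<close> after replacing x by 1/x and multiplying by
  the power of x; it is the form that the differential operator produces.\<close>

primrec euler_frac_rev :: "nat \<Rightarrow> nat \<Rightarrow> real poly" where
  "euler_frac_rev k 0 = 1"
| "euler_frac_rev k (Suc n) = [:0, real k * real n + 1:] * euler_frac_rev k n
     + [:0, real k, - real k:] * pderiv (euler_frac_rev k n)"

lemma poly_euler_frac_rev:
  "x \<noteq> 0 \<Longrightarrow> poly (euler_frac_rev k n) x = x ^ n * poly (euler_frac k n) (1 / x)"
proof (induction n arbitrary: x)
  case 0
  then show ?case by simp
next
  case (Suc n)
  let ?A = "poly (euler_frac k n) (1 / x)" and ?A' = "poly (pderiv (euler_frac k n)) (1 / x)"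
  have "((\<lambda>x. x ^ n * poly (euler_frac k n) (1 / x)) has_real_derivative
      real n * x ^ (n - 1) * ?A - x ^ n * ?A' / x\<^sup>2) (at x)"
    using DERIV_mult[OF DERIV_pow DERIV_chain2[OF poly_DERIV DERIV_inverse[OF Suc.prems]],
        of n "euler_frac k n"]
    by (simp add: divide_inverse power2_eq_square algebra_simps)
  \<comment> \<open>The induction hypothesis holds on the open set of nonzero reals, so it may be
    differentiated.\<close>
  then have "(poly (euler_frac_rev k n) has_real_derivative
      real n * x ^ (n - 1) * ?A - x ^ n * ?A' / x\<^sup>2) (at x)"
    by (rule has_field_derivative_transform_within_open[where S = "- {0}"])
      (use Suc in auto)
  then have "poly (pderiv (euler_frac_rev k n)) x = real n * x ^ (n - 1) * ?A - x ^ n * ?A' / x\<^sup>2"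
    using DERIV_unique poly_DERIV by blast
  moreover have "real n * x ^ (n - 1) = real n * x ^ n / x"
    using Suc.prems by (cases n) auto
  ultimately have deriv: "poly (pderiv (euler_frac_rev k n)) x = x ^ n * (real n * ?A / x - ?A' / x\<^sup>2)"
    by (simp only: right_diff_distrib) simp
  show ?case
    using Suc.prems by (simp add: Suc.IH deriv) (simp add: field_simps power2_eq_square)
qed

lemma reversed_poly_euler_frac: "reversed_poly n (euler_frac k n) = euler_frac_rev k n"
  unfolding reversed_poly_def
proof (rule the_equality)
  fix q
  assume "\<forall>x. x \<noteq> 0 \<longrightarrow> poly q x = x ^ n * poly (euler_frac k n) (1 / x)"
  then show "q = euler_frac_rev k n"
    by (intro poly_eqI_cofinite[where c = 0]) (simp add: poly_euler_frac_rev)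
qed (simp add: poly_euler_frac_rev)

section \<open>Differential calculus for series in z with coefficients polynomial in x\<close>

definition fps_pderiv :: "real poly fps \<Rightarrow> real poly fps" where
  "fps_pderiv F = Abs_fps (\<lambda>n. pderiv (F $ n))"

lemma fps_pderiv_nth [simp]: "fps_pderiv F $ n = pderiv (F $ n)"
  by (simp add: fps_pderiv_def)

lemma fps_pderiv_diff: "fps_pderiv (F - G) = fps_pderiv F - fps_pderiv G"
  by (rule fps_ext) (simp add: pderiv_diff)

lemma fps_pderiv_mult: "fps_pderiv (F * G) = fps_pderiv F * G + F * fps_pderiv G"
proof (rule fps_ext)
  fix n
  have "pderiv (p * q) = pderiv p * q + p * pderiv q" for p q :: "real poly"
    by (simp add: pderiv_mult)
  then show "fps_pderiv (F * G) $ n = (fps_pderiv F * G + F * fps_pderiv G) $ n"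
    by (simp add: fps_mult_nth pderiv_sum sum.distrib)
qed

text \<open>Evaluation of the coefficients at a real x. Being multiplicative, it carries identities
  over polynomials in x to the real series in \<open>frac_eulerian_gf\<close>.\<close>

definition fps_poly :: "real \<Rightarrow> real poly fps \<Rightarrow> real fps" where
  "fps_poly x F = Abs_fps (\<lambda>n. poly (F $ n) x)"

lemma fps_poly_nth [simp]: "fps_poly x F $ n = poly (F $ n) x"
  by (simp add: fps_poly_def)

lemma fps_poly_mult: "fps_poly x (F * G) = fps_poly x F * fps_poly x G"
  by (rule fps_ext) (simp add: fps_mult_nth poly_sum)

lemma fps_poly_power: "fps_poly x (F ^ m) = fps_poly x F ^ m"
proof (induction m)
  case 0
  show ?case by (rule fps_ext) simp
qed (simp add: fps_poly_mult)

text \<open>The generating function \<open>F\<close> of the \<open>1/k\<close>-Eulerian polynomials satisfies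
  \<open>(1 - k x z) F\<^sub>z - k x (1 - x) F\<^sub>x = F\<close>, which restates the recurrence of \<open>euler_frac\<close>.
  The operator on the left is a derivation.\<close>

definition euler_pde :: "nat \<Rightarrow> real poly fps \<Rightarrow> real poly fps" where
  "euler_pde k F = (1 - fps_const [:0, real k:] * fps_X) * fps_deriv F
     - fps_const [:0, real k, - real k:] * fps_pderiv F"

lemma euler_pde_nth:
  "euler_pde k F $ n = of_nat (Suc n) * F $ Suc n - [:0, real k:] * (of_nat n * F $ n)
     - [:0, real k, - real k:] * pderiv (F $ n)"
  by (cases n) (simp_all add: euler_pde_def left_diff_distrib mult.assoc)

lemma euler_pde_diff: "euler_pde k (F - G) = euler_pde k F - euler_pde k G"
  by (simp add: euler_pde_def fps_pderiv_diff algebra_simps)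

lemma euler_pde_mult: "euler_pde k (F * G) = euler_pde k F * G + F * euler_pde k G"
  by (simp add: euler_pde_def fps_pderiv_mult algebra_simps)

lemma euler_pde_power:
  assumes "euler_pde k F = F"
  shows "euler_pde k (F ^ m) = fps_const [:real m:] * F ^ m"
proof (induction m)
  case 0
  show ?case by (rule fps_ext) (simp add: euler_pde_nth)
next
  case (Suc m)
  have const: "fps_const [:real (Suc m):] = 1 + fps_const [:real m:]"
    by (rule fps_ext) (simp add: one_pCons)
  show ?case
    unfolding power_Suc euler_pde_mult Suc assms const by (simp add: algebra_simps)
qed

text \<open>Coefficient n of the equation expresses (n + 1) times coefficient n + 1 of the series
  through coefficient n, so the constant term in z determines everything.\<close>

lemma euler_pde_unique:
  assumes "euler_pde k F = fps_const c * F" and "euler_pde k G = fps_const c * G"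
    and "F $ 0 = G $ 0"
  shows "F = G"
proof (rule fps_ext)
  fix n
  show "F $ n = G $ n"
  proof (induction n)
    case (Suc n)
    have "euler_pde k F $ n = euler_pde k G $ n"
      by (simp add: assms Suc)
    then have "of_nat (Suc n) * F $ Suc n = of_nat (Suc n) * G $ Suc n"
      by (simp add: euler_pde_nth Suc del: of_nat_Suc)
    then show ?case
      by (simp only: mult_cancel_left of_nat_eq_0_iff) simp
  qed (rule assms)
qed

definition euler_frac_fps :: "nat \<Rightarrow> real poly fps" where
  "euler_frac_fps k = Abs_fps (\<lambda>n. smult (1 / fact n) (euler_frac k n))"

text \<open>The expansion of exp(k z (x - 1)) in powers of z.\<close>

definition exp_fps :: "nat \<Rightarrow> real poly fps" where
  "exp_fps k = Abs_fps (\<lambda>n. smult (real k ^ n / fact n) ([:-1, 1:] ^ n))"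

lemma euler_pde_euler_frac_fps: "euler_pde k (euler_frac_fps k) = euler_frac_fps k"
proof (rule fps_ext)
  fix n
  have "real (Suc n) / fact (Suc n) = 1 / fact n"
    by simp
  then show "euler_pde k (euler_frac_fps k) $ n = euler_frac_fps k $ n"
    unfolding euler_pde_nth of_nat_mult_poly
    by (intro poly_eqI_cofinite[where c = 0])
      (simp add: euler_frac_fps_def pderiv_smult field_simps del: of_nat_Suc fact_Suc)
qed

text \<open>For E = exp(k z (x - 1)), E_z = k (x - 1) E and E_x = k z E; the two terms with k^2 x (x
  - 1) z cancel and k (x - 1) E is left.\<close>

lemma euler_pde_exp_fps:
  "euler_pde k (exp_fps k) = fps_const [:- real k, real k:] * exp_fps k"
proof (rule fps_ext)
  fix n
  have *: "real (Suc n) * (real k ^ Suc n / fact (Suc n)) = real k * (real k ^ n / fact n)"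
    by simp
  \<comment> \<open>The factor x - 1 restores the exponent n, which avoids n - 1 at n = 0.\<close>
  have deriv: "(x - 1) * poly (pderiv ([:-1, 1:] ^ n)) x = real n * (x - 1) ^ n" for x :: real
    by (cases n) (simp_all add: pderiv_power_Suc pderiv_pCons del: power_Suc of_nat_Suc, simp)
  show "euler_pde k (exp_fps k) $ n = (fps_const [:- real k, real k:] * exp_fps k) $ n"
  proof (rule poly_eqI_cofinite)
    fix x :: real
    define c where "c = real k ^ n / fact n"
    have "poly (euler_pde k (exp_fps k) $ n) x = real k * c * (x - 1) ^ Suc n
        - real k * x * c * (real n * (x - 1) ^ n)
        + real k * x * c * ((x - 1) * poly (pderiv ([:-1, 1:] ^ n)) x)"
      unfolding euler_pde_nth of_nat_mult_poly c_def *[symmetric]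
      by (simp add: exp_fps_def pderiv_smult algebra_simps del: of_nat_Suc fact_Suc power_Suc)
    also have "\<dots> = real k * c * (x - 1) ^ Suc n"
      by (simp add: deriv)
    finally show "poly (euler_pde k (exp_fps k) $ n) x
        = poly ((fps_const [:- real k, real k:] * exp_fps k) $ n) x"
      by (simp add: exp_fps_def c_def algebra_simps)
  qed
qed

text \<open>Under a derivation eigenvalues add: F^k contributes k and exp(k z (x - 1)) - x
  contributes k (x - 1), giving k x for the product.\<close>

lemma euler_frac_fps_power:
  "euler_frac_fps k ^ k * (exp_fps k - fps_const [:0, 1:]) = fps_const [:1, -1:]"
proof (rule euler_pde_unique)
  have const: "euler_pde k (fps_const p) = - fps_const ([:0, real k, - real k:] * pderiv p)" for p
    by (rule fps_ext) (auto simp: euler_pde_nth)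
  have const_add: "fps_const [:0, real k:] = fps_const [:- real k, real k:] + fps_const [:real k:]"
    by simp
  have diff: "euler_pde k (exp_fps k - fps_const [:0, 1:])
      = fps_const [:- real k, real k:] * (exp_fps k - fps_const [:0, 1:])"
    by (simp add: euler_pde_diff euler_pde_exp_fps const pderiv_pCons right_diff_distrib)
  show "euler_pde k (euler_frac_fps k ^ k * (exp_fps k - fps_const [:0, 1:])) =
      fps_const [:0, real k:] * (euler_frac_fps k ^ k * (exp_fps k - fps_const [:0, 1:]))"
    unfolding euler_pde_mult euler_pde_power[OF euler_pde_euler_frac_fps] diff const_add
    by (simp only: algebra_simps)
  show "euler_pde k (fps_const [:1, -1:]) = fps_const [:0, real k:] * fps_const [:1, -1:]"
    by (simp add: const pderiv_pCons)
qed (simp add: euler_frac_fps_def exp_fps_def fps_power_zeroth flip: one_pCons, simp add: one_pCons)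

lemma frac_eulerian_gf_eq:
  assumes "k \<ge> 1" and "x \<noteq> 1"
  shows "frac_eulerian_gf k x = Abs_fps (\<lambda>n. poly (euler_frac k n) x / fact n)"
proof -
  define F where "F = Abs_fps (\<lambda>n. poly (euler_frac k n) x / fact n)"
  define E where "E = fps_exp (real k * (x - 1)) - fps_const x"
  have "fps_poly x (euler_frac_fps k) = F"
    by (rule fps_ext) (simp add: euler_frac_fps_def F_def)
  moreover have "fps_poly x (exp_fps k - fps_const [:0, 1:]) = E"
    by (rule fps_ext) (simp add: exp_fps_def E_def power_mult_distrib)
  moreover have "fps_poly x (fps_const [:1, -1:]) = fps_const (1 - x)"
    by (rule fps_ext) simp
  ultimately have "F ^ k * E = fps_const (1 - x)"
    by (metis euler_frac_fps_power fps_poly_mult fps_poly_power)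
  \<comment> \<open>The constant term of \<open>E\<close> is 1 - x, nonzero by assumption.\<close>
  moreover have "E \<noteq> 0"
    using assms by (auto simp: E_def fps_eq_iff intro!: exI[of _ 0])
  ultimately have quot: "fps_const (1 - x) / E = F ^ k"
    by (metis nonzero_mult_div_cancel_right)
  have "F $ 0 = 1"
    by (simp add: F_def)
  then have "fps_radical root k (F ^ k) = F"
    using radical_unique[of root "k - 1" "F ^ k" F] assms by (simp add: fps_power_zeroth)
  then show ?thesis
    by (simp add: frac_eulerian_gf_def quot flip: E_def F_def)
qed

lemma frac_eulerian_poly_eq:
  assumes "k \<ge> 1"
  shows "frac_eulerian_poly k = euler_frac k"
  unfolding frac_eulerian_poly_def
proof (rule the_equality)
  fix A
  assume A: "\<forall>x. x \<noteq> 1 \<longrightarrow> Abs_fps (\<lambda>n. poly (A n) x / fact n) = frac_eulerian_gf k x"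
  show "A = euler_frac k"
  proof (rule ext, rule poly_eqI_cofinite[where c = 1])
    fix n and x :: real
    assume "x \<noteq> 1"
    then show "poly (A n) x = poly (euler_frac k n) x"
      using A assms by (auto simp: frac_eulerian_gf_eq fps_eq_iff)
  qed
qed (use assms in \<open>simp add: frac_eulerian_gf_eq\<close>)

section \<open>The operator identities\<close>

lemma diff_op_m_eulerian_poly:
  fixes x :: real
  assumes "x < 1"
  shows "(diff_op (\<lambda>x. x / (1 - x) ^ k) ^^ n) (\<lambda>x. 1 / (1 - x)) x
    = poly (m_eulerian_poly (k + 1) n) x / (1 - x) ^ (n + k * n + 1)"
proof -
  have "(diff_op (\<lambda>x. x / (1 - x) ^ k) ^^ n) (\<lambda>x. 1 / (1 - x)) x
      = poly (m_eulerian_poly (k + 1) n) x / (1 - x) powr real (n + k * n + 1)"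
  \<comment> \<open>With block size m = k + 1 the number of gaps, mn + 1, is exactly the exponent n
    + kn + 1.\<close>
  proof (rule diff_op_funpow_quotient[where c = 1 and k = k])
    fix n
    show "m_eulerian_poly (k + 1) (Suc n) =
        smult 1 ([:0, 1:] * ([:1, -1:] * pderiv (m_eulerian_poly (k + 1) n)
          + smult (real (n + k * n + 1)) (m_eulerian_poly (k + 1) n)))"
      by (rule poly_eqI_cofinite[where c = 0]) (simp add: m_eulerian_poly_Suc algebra_simps)
  qed (use assms in \<open>auto simp: m_eulerian_poly_def stirling_perms_0 des_def algebra_simps\<close>)
  then show ?thesis
    using assms by (simp only: powr_realpow)
qed

theorem theorem1:
  fixes k n :: nat and x :: real
  assumes "k \<ge> 1" and "n \<ge> 1" and "x < 1"
  shows "(diff_op (\<lambda>x. x / (1 - x) ^ k) ^^ n) (\<lambda>x. 1 / (1 - x)) x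
           = poly (m_eulerian_poly (k + 1) n) x / (1 - x) ^ (n + k * n + 1)
       \<and> (diff_op (\<lambda>x. real k * x) ^^ n) (\<lambda>x. 1 / (1 - x) powr (1 / real k)) x
           = poly (reversed_poly n (frac_eulerian_poly k n)) x / (1 - x) powr (real n + 1 / real k)
       \<and> (diff_op (\<lambda>x. x / (1 - x)) ^^ n) (\<lambda>x. 1 / (1 - x)) x
           = poly (second_order_eulerian_poly n) x / (1 - x) ^ (2 * n + 1)
       \<and> (diff_op (\<lambda>x. 2 * x) ^^ n) (\<lambda>x. 1 / sqrt (1 - x)) x
           = poly (lap_poly n) x / ((1 - x) ^ n * sqrt (1 - x))"
proof (intro conjI)
  show "(diff_op (\<lambda>x. x / (1 - x) ^ k) ^^ n) (\<lambda>x. 1 / (1 - x)) x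
      = poly (m_eulerian_poly (k + 1) n) x / (1 - x) ^ (n + k * n + 1)"
    by (rule diff_op_m_eulerian_poly[OF \<open>x < 1\<close>])
  show "(diff_op (\<lambda>x. x / (1 - x)) ^^ n) (\<lambda>x. 1 / (1 - x)) x
      = poly (second_order_eulerian_poly n) x / (1 - x) ^ (2 * n + 1)"
    using diff_op_m_eulerian_poly[OF \<open>x < 1\<close>, where k = 1 and n = n]
    by (simp add: second_order_eulerian_poly_def numeral_2_eq_2)
  have "(diff_op (\<lambda>x. real k * x) ^^ n) (\<lambda>x. 1 / (1 - x) powr (1 / real k)) x
      = poly (euler_frac_rev k n) x / (1 - x) powr (real n + 1 / real k)"
  proof (rule diff_op_funpow_quotient[where c = "real k" and k = 0])
    fix n
    show "euler_frac_rev k (Suc n) = smult (real k) ([:0, 1:] *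
        ([:1, -1:] * pderiv (euler_frac_rev k n) + smult (real n + 1 / real k) (euler_frac_rev k n)))"
      using \<open>k \<ge> 1\<close> by (intro poly_eqI_cofinite[where c = 0]) (simp add: field_simps)
  qed (use assms in auto)
  then show "(diff_op (\<lambda>x. real k * x) ^^ n) (\<lambda>x. 1 / (1 - x) powr (1 / real k)) x
      = poly (reversed_poly n (frac_eulerian_poly k n)) x / (1 - x) powr (real n + 1 / real k)"
    by (simp add: frac_eulerian_poly_eq[OF \<open>k \<ge> 1\<close>] reversed_poly_euler_frac)
  have "(diff_op (\<lambda>x. 2 * x) ^^ n) (\<lambda>x. 1 / sqrt (1 - x)) x
      = poly (lap_poly n) x / (1 - x) powr (real n + 1 / 2)"
  \<comment> \<open>The factor 2 in \<open>lap_poly_Suc\<close> is taken out: 2n + 1 = 2 (n + 1/2),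
    which gives the exponent n + 1/2.\<close>
  proof (rule diff_op_funpow_quotient[where c = 2 and k = 0])
    fix n
    show "lap_poly (Suc n) = smult 2 ([:0, 1:] *
        ([:1, -1:] * pderiv (lap_poly n) + smult (real n + 1 / 2) (lap_poly n)))"
      by (rule poly_eqI_cofinite[where c = 0]) (simp add: lap_poly_Suc algebra_simps)
  qed (use assms in \<open>auto simp: lap_poly_def stirling_perms_0 lap_def powr_half_sqrt\<close>)
  then show "(diff_op (\<lambda>x. 2 * x) ^^ n) (\<lambda>x. 1 / sqrt (1 - x)) x
      = poly (lap_poly n) x / ((1 - x) ^ n * sqrt (1 - x))"
    using \<open>x < 1\<close> by (simp add: powr_add powr_realpow powr_half_sqrt)
qed

end
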